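(* Let $\mathcal{A}=\lambda/\mu$ be a skew diagram. Then $hl(\mathcal{A})=\pi_{nw}(\mathcal{A})$.
   Context: Partitions are identified with Young diagrams in matrix coordinates. For $\mu\subseteq\lambda$ the skew diagram $\lambda/\mu$ is the set of boxes of $\lambda$ not in $\mu$. The skew character is $[\lambda/\mu]=\sum_\nu c(\lambda;\mu,\nu)[\nu]$ with $c$ the Littlewood–Richardson coefficients and $[\nu]$ irreducible characters of the symmetric group; $[\nu]$ appears in $[\mathcal{A}]$ iff its coefficient is nonzero. Northwest ribbons: $nw_1(\mathcal{A})$ is the set of boxes $(i,j)\in\mathcal{A}$ with $(i-1,j-1)\notin\mathcal{A}$ (for connected $\mathcal{A}$, the ribbon along the northwest border from the lowest box of the leftmost column to the rightmost box of the top row; for disconnected $\mathcal{A}$, the union of the $nw_1$ of its connected components), and $nw_{k+1}(\mathcal{A})$ is $nw_1$ of the diagram obtained from $\mathcal{A}$ by removing $nw_1(\mathcal{A}),\dots,nw_k(\mathcal{A})$. $\pi_{nw}(\mathcal{A})=(|nw_1(\mathcal{A})|,|nw_2(\mathcal{A})|,\dots)$. For a partition $\nu$, $hl_i(\nu)$ is the hook length of box $(i,i)$ (zero if absent) and $hl(\nu)=(hl_1(\nu),hl_2(\nu),\dots)$; $hl(\mathcal{A})$ is the lexicographically largest $hl(\nu)$ among all $\nu$ with $[\nu]$ appearing in $[\mathcal{A}]$. *)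

theory Defs
  imports Main "HOL-Library.Fun_Lexorder"
begin

definition is_partition :: "nat list \<Rightarrow> bool" where
  "is_partition p \<longleftrightarrow> sorted_wrt (\<ge>) p \<and> 0 \<notin> set p"

text \<open>Parts are numbered from 1, and all parts beyond the length of the list are 0.\<close>

definition part :: "nat list \<Rightarrow> nat \<Rightarrow> nat" where
  "part p i = (if 1 \<le> i \<and> i \<le> length p then p ! (i - 1) else 0)"

text \<open>Boxes are (row, column) in matrix coordinates, both numbered from 1.\<close>

type_synonym diagram = "(nat \<times> nat) set"

definition young :: "nat list \<Rightarrow> diagram" where
  "young p = {(i, j). 1 \<le> i \<and> 1 \<le> j \<and> j \<le> part p i}"

definition skew :: "nat list \<Rightarrow> nat list \<Rightarrow> diagram" where
  "skew lam mu = young lam - young mu"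


text \<open>
  A tableau is a map from boxes to positive integers; it is set to 0 outside the diagram so that
  fillings of a diagram correspond to exactly one such map.
\<close>

definition semistandard :: "diagram \<Rightarrow> (nat \<times> nat \<Rightarrow> nat) \<Rightarrow> bool" where
  "semistandard A T \<longleftrightarrow>
     (\<forall>b. b \<notin> A \<longrightarrow> T b = 0) \<and>
     (\<forall>b\<in>A. 1 \<le> T b) \<and>
     (\<forall>i j j'. (i, j) \<in> A \<and> (i, j') \<in> A \<and> j < j' \<longrightarrow> T (i, j) \<le> T (i, j')) \<and>
     (\<forall>i i' j. (i, j) \<in> A \<and> (i', j) \<in> A \<and> i < i' \<longrightarrow> T (i, j) < T (i', j))"

text \<open>The tableau word reads the rows from top to bottom, each row from right to left.\<close>

definition tableau_word :: "nat list \<Rightarrow> nat list \<Rightarrow> (nat \<times> nat \<Rightarrow> nat) \<Rightarrow> nat list" where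
  "tableau_word lam mu T =
     concat (map (\<lambda>i. map (\<lambda>j. T (i, j)) (rev [Suc (part mu i)..<Suc (part lam i)]))
       [1..<Suc (length lam)])"

definition lattice_word :: "nat list \<Rightarrow> bool" where
  "lattice_word w \<longleftrightarrow>
     (\<forall>n k. 1 \<le> k \<longrightarrow> count_list (take n w) (Suc k) \<le> count_list (take n w) k)"

definition LR_tableaux ::
    "nat list \<Rightarrow> nat list \<Rightarrow> nat list \<Rightarrow> (nat \<times> nat \<Rightarrow> nat) set" where
  "LR_tableaux lam mu nu =
     {T. semistandard (skew lam mu) T \<and>
         (\<forall>k\<ge>1. card {b \<in> skew lam mu. T b = k} = part nu k) \<and>
         lattice_word (tableau_word lam mu T)}"

text \<open>The Littlewood--Richardson coefficient c(lam; mu, nu).\<close>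

definition LR_coeff :: "nat list \<Rightarrow> nat list \<Rightarrow> nat list \<Rightarrow> nat" where
  "LR_coeff lam mu nu = (if young mu \<subseteq> young lam then card (LR_tableaux lam mu nu) else 0)"

text \<open>
  A character of a symmetric group is represented by its coordinates with respect to the basis
  of irreducible characters [nu], nu ranging over the partitions. The skew character [lam/mu] is
  the sum of the c(lam; mu, nu) [nu].
\<close>

definition skew_char :: "nat list \<Rightarrow> nat list \<Rightarrow> (nat list \<Rightarrow> nat)" where
  "skew_char lam mu = (\<lambda>nu. if is_partition nu then LR_coeff lam mu nu else 0)"

definition appears_in :: "nat list \<Rightarrow> (nat list \<Rightarrow> nat) \<Rightarrow> bool" where
  "appears_in nu chi \<longleftrightarrow> is_partition nu \<and> chi nu \<noteq> 0"


definition hook_length :: "nat list \<Rightarrow> nat \<times> nat \<Rightarrow> nat" where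
  "hook_length nu = (\<lambda>(i, j).
     if (i, j) \<in> young nu
     then card {(r, c) \<in> young nu. (r = i \<and> j \<le> c) \<or> (c = j \<and> i \<le> r)}
     else 0)"

text \<open>
  Sequences are functions on nat, entry n being the term of index n + 1; they are compared by
  the lexicographic order \<^const>\<open>less_fun\<close>.
\<close>

definition hl :: "nat list \<Rightarrow> (nat \<Rightarrow> nat)" where
  "hl nu = (\<lambda>n. hook_length nu (Suc n, Suc n))"

definition lex_greatest :: "(nat \<Rightarrow> nat) set \<Rightarrow> (nat \<Rightarrow> nat)" where
  "lex_greatest S = (THE h. h \<in> S \<and> (\<forall>h'\<in>S. h' = h \<or> less_fun h' h))"

definition hl_skew :: "nat list \<Rightarrow> nat list \<Rightarrow> (nat \<Rightarrow> nat)" where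
  "hl_skew lam mu = lex_greatest {hl nu |nu. appears_in nu (skew_char lam mu)}"


text \<open>
  Row and column indices of boxes are at least 1, so the subtractions do not truncate. In a skew
  diagram, if (i, j) and (i - 1, j - 1) are boxes then so is (i - 1, j); hence both lie in the same
  connected component, and this is also the union of the ribbons of the components.
\<close>

definition nw1 :: "diagram \<Rightarrow> diagram" where
  "nw1 A = {(i, j) \<in> A. (i - 1, j - 1) \<notin> A}"

text \<open>The ribbons \<open>nw A k\<close> are numbered from k = 1.\<close>

fun nw :: "diagram \<Rightarrow> nat \<Rightarrow> diagram" where
  "nw A k = nw1 (A - (\<Union>l\<in>{1..<k}. nw A l))"

declare nw.simps [simp del]

definition pi_nw :: "diagram \<Rightarrow> (nat \<Rightarrow> nat)" where
  "pi_nw A = (\<lambda>n. card (nw A (Suc n)))"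

end

theory Submission
  imports Defs
begin

text \<open>
  Call the index of the ribbon containing a box of \<open>\<A>\<close> the depth of the box. Since \<open>\<pi>\<^sub>n\<^sub>w\<close> and \<open>hl\<close>
  are the difference sequences of the number of boxes of depth \<open>> k\<close> in \<open>\<A>\<close> and of the number of
  boxes \<open>(r, c)\<close> of \<open>\<nu>\<close> with \<open>r, c > k\<close>, it suffices to compare these numbers.

  In a Littlewood-Richardson tableau of content \<open>\<nu>\<close>, let the \<open>c\<close>-th \<open>r\<close> in reading order
  correspond to the box \<open>(r, c)\<close> of \<open>\<nu>\<close>. Row \<open>i\<close> has entries \<open>\<le> k\<close> only in columns up to
  \<open>\<mu>\<^sub>i\<^sub>-\<^sub>k\<close>, and, by the lattice property, at most \<open>k\<close> of its other entries correspond to boxes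
  with \<open>c \<le> k\<close>. So at least as many of its entries have \<open>r, c > k\<close> as the row has boxes of depth
  \<open>> k\<close>, namely those beyond column \<open>\<mu>\<^sub>i\<^sub>-\<^sub>k + k\<close>.

  Equality for all \<open>k\<close> is attained by an explicit tableau: a box of depth \<open>k\<close> yields the entry \<open>k\<close>
  if the box above it has smaller depth or is missing, and the remaining boxes of depth \<open>k\<close>, from
  top to bottom, yield \<open>k + 1, k + 2, \<dots>\<close>; finally each row is sorted.
\<close>

section \<open>Depth in a skew shape\<close>

locale skew_shape =
  fixes L M :: "nat \<Rightarrow> nat" and n :: nat
  assumes L_Suc: "1 \<le> i \<Longrightarrow> L (Suc i) \<le> L i"
    and M_Suc: "1 \<le> i \<Longrightarrow> M (Suc i) \<le> M i"
    and M_le_L: "M i \<le> L i"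
    and L_eq_0: "n < i \<Longrightarrow> L i = 0"
begin

lemma L_antimono:
  assumes "1 \<le> i" and "i \<le> j"
  shows "L j \<le> L i"
  using assms(2)
proof (induction j rule: dec_induct)
  case (step j)
  then show ?case using L_Suc[of j] assms(1) by linarith
qed simp

lemma M_antimono:
  assumes "1 \<le> i" and "i \<le> j"
  shows "M j \<le> M i"
  using assms(2)
proof (induction j rule: dec_induct)
  case (step j)
  then show ?case using M_Suc[of j] assms(1) by linarith
qed simp

text \<open>
  In row \<open>i\<close> the boxes of depth at most \<open>k\<close>, i.e. those of the ribbons \<open>1, \<dots>, k\<close>, are the boxes
  in columns up to \<open>bound i k\<close>. For \<open>i \<le> k\<close> this is every box of the row, so any bound
  \<open>\<ge> L i\<close> would do; \<open>L 1 + k\<close> makes the recursion along diagonals hold without exception.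
\<close>

definition bound :: "nat \<Rightarrow> nat \<Rightarrow> nat" where
  "bound i k = (if i \<le> k then L 1 else M (i - k)) + k"

lemma bound_0: "1 \<le> i \<Longrightarrow> bound i 0 = M i"
  by (simp add: bound_def)

lemma bound_Suc_Suc: "bound (Suc i) (Suc k) = Suc (bound i k)"
  by (simp add: bound_def)

lemma bound_less_Suc:
  assumes "1 \<le> i"
  shows "bound i k < bound i (Suc k)"
proof -
  consider "i \<le> k" | "i = Suc k" | "Suc k < i" by linarith
  then show ?thesis
  proof cases
    case 3
    then have "M (i - k) \<le> M (i - Suc k)"
      using M_Suc[of "i - Suc k"] by (simp add: Suc_diff_Suc)
    with 3 show ?thesis by (simp add: bound_def)
  qed (use M_le_L[of 1] in \<open>auto simp: bound_def\<close>)
qed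

lemma M_le_bound: "1 \<le> i \<Longrightarrow> M i \<le> bound i k"
proof (induction k)
  case (Suc k)
  then show ?case using bound_less_Suc[of i k] by linarith
qed (simp add: bound_0)

lemma L_add_le_bound: "1 \<le> i \<Longrightarrow> i \<le> k \<Longrightarrow> L i + k \<le> bound i k"
  using L_antimono[of 1 i] by (simp add: bound_def)


subsection \<open>The extremal filling\<close>

text \<open>
  A box of depth \<open>k\<close> is vertical if the box above it has depth \<open>k\<close> too. Row \<open>i\<close> contains at most
  one vertical box of depth \<open>k\<close>, namely in column \<open>bound i k\<close>; \<open>tops k i\<close> counts the others. The
  vertical box yields the entry \<open>k + nvert k i\<close>, so \<open>mult i s\<close> is the multiplicity of \<open>s\<close> in row \<open>i\<close>.
\<close>

definition vert :: "nat \<Rightarrow> nat \<Rightarrow> bool" where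
  "vert k i \<longleftrightarrow> bound i k \<le> L i"

definition nvert :: "nat \<Rightarrow> nat \<Rightarrow> nat" where
  "nvert k i = (\<Sum>x=1..i. of_bool (vert k x))"

definition tops :: "nat \<Rightarrow> nat \<Rightarrow> nat" where
  "tops k i = min (L i) (bound i k - 1) - min (L i) (bound i (k - 1))"

definition mult :: "nat \<Rightarrow> nat \<Rightarrow> nat" where
  "mult i s = tops s i + (\<Sum>k=1..<s. of_bool (vert k i \<and> k + nvert k i = s))"

text \<open>The column at which the entries up to \<open>r\<close> end once row \<open>i\<close> is
  sorted.\<close>

definition upto_col :: "nat \<Rightarrow> nat \<Rightarrow> nat" where
  "upto_col r i = M i + (\<Sum>s=1..r. mult i s)"

lemma vert_SucD:
  assumes "1 \<le> i" and "vert (Suc k) i"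
  shows "vert k i"
  using assms bound_less_Suc[of i k] by (simp add: vert_def)

lemma vert_antimono:
  assumes "1 \<le> i" and "k \<le> l" and "vert l i"
  shows "vert k i"
  using assms(2,3) by (induction l rule: dec_induct) (blast dest: vert_SucD[OF assms(1)])+

lemma vert_imp_less: "1 \<le> k \<Longrightarrow> 1 \<le> i \<Longrightarrow> vert k i \<Longrightarrow> k < i"
  using L_add_le_bound[of i k] by (fastforce simp: vert_def)

lemma nvert_Suc: "nvert k (Suc i) = nvert k i + of_bool (vert k (Suc i))"
  by (simp add: nvert_def)

lemma nvert_le: "1 \<le> k \<Longrightarrow> nvert k i \<le> i - k"
proof (induction i)
  case (Suc i)
  then show ?case using vert_imp_less[of k "Suc i"] by (auto simp: nvert_Suc)
qed (simp add: nvert_def)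

lemma tops_add_vert:
  assumes "1 \<le> i"
  shows "min (L i) (bound i k) + tops (Suc k) i + of_bool (vert (Suc k) i)
           = min (L i) (bound i (Suc k))"
  using bound_less_Suc[OF assms, of k] by (auto simp: tops_def vert_def)

text \<open>Entries are at least the depth of their box, so entries up to \<open>r\<close> come from
  boxes of depth up to \<open>r\<close>. The sum counts the exceptions: vertical boxes of such depth
  whose entry exceeds \<open>r\<close>.\<close>

lemma upto_col_add:
  assumes "1 \<le> i"
  shows "upto_col r i + (\<Sum>k=1..r. of_bool (vert k i \<and> r < k + nvert k i))
           = min (L i) (bound i r)"
proof (induction r)
  case 0
  then show ?case using assms M_le_L[of i] by (simp add: upto_col_def bound_0)
next
  case (Suc r)
  \<comment> \<open>A vertical box counts itself in \<open>nvert\<close>, so its entry exceeds its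
    depth.\<close>
  have pos: "0 < nvert (Suc r) i" if "vert (Suc r) i"
    using assms that nvert_Suc[of "Suc r" "i - 1"] by simp
  have "(\<Sum>k=1..r. of_bool (vert k i \<and> r < k + nvert k i) :: nat)
      = (\<Sum>k=1..r. of_bool (vert k i \<and> k + nvert k i = Suc r)
          + of_bool (vert k i \<and> Suc r < k + nvert k i))"
    by (intro sum.cong) auto
  with Suc pos tops_add_vert[OF assms, of r] show ?case
    by (cases "vert (Suc r) i")
      (auto simp: upto_col_def mult_def sum.distrib atLeastLessThanSuc_atLeastAtMost)
qed

lemma upto_col_le: "1 \<le> i \<Longrightarrow> upto_col r i \<le> L i"
  using upto_col_add[of i r] by linarith

text \<open>No entry of row \<open>i\<close> exceeds \<open>i\<close>: a vertical box of depth
  \<open>k\<close> has at most \<open>i - k\<close> vertical boxes of that depth down to its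
  row.\<close>

lemma upto_col_eq_L:
  assumes "1 \<le> i" and "i \<le> r"
  shows "upto_col r i = L i"
proof -
  have "\<not> (vert k i \<and> r < k + nvert k i)" if "k \<in> {1..r}" for k
    using vert_imp_less[of k i] nvert_le[of k i] that assms by auto
  then have "(\<Sum>k=1..r. of_bool (vert k i \<and> r < k + nvert k i) :: nat) = 0"
    by (auto intro!: sum.neutral)
  with upto_col_add[OF assms(1), of r] L_add_le_bound[OF assms] show ?thesis by simp
qed

lemma upto_col_mono: "r \<le> s \<Longrightarrow> upto_col r i \<le> upto_col s i"
  unfolding upto_col_def by (intro add_left_mono sum_mono2) auto

text \<open>If depth \<open>k\<close> has a vertical box in row \<open>i\<close> but none in row
  \<open>Suc i\<close>, the former lies beyond the end of row \<open>Suc i\<close>. These boxes have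
  distinct columns, so they fit between \<open>L (Suc i)\<close> and
  \<open>bound i r\<close>.\<close>

lemma lost_verts:
  assumes "1 \<le> i" and "L (Suc i) \<le> bound i r"
  shows "L (Suc i) + (\<Sum>k=1..r. of_bool (vert k i \<and> \<not> vert k (Suc i))) \<le> min (L i) (bound i r)"
  using assms(2)
proof (induction r)
  case 0
  then show ?case using L_Suc[OF assms(1)] by simp
next
  case (Suc r)
  show ?case
  proof (cases "vert (Suc r) (Suc i)")
    case True
    then have "\<And>k. k \<in> {1..Suc r} \<Longrightarrow> vert k (Suc i)"
      using vert_antimono[of "Suc i" _ "Suc r"] by simp
    then have "(\<Sum>k=1..Suc r. of_bool (vert k i \<and> \<not> vert k (Suc i)) :: nat) = 0"
      by (intro sum.neutral) simp
    then show ?thesis using Suc.prems L_Suc[OF assms(1)] by presburger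
  next
    case False
    then have "L (Suc i) \<le> bound i r" by (simp add: vert_def bound_Suc_Suc)
    from Suc.IH[OF this] bound_less_Suc[OF assms(1), of r] show ?thesis
      by (auto simp: vert_def)
  qed
qed

text \<open>This gives strict columns after sorting. A vertical box of depth \<open>k\<close> in
  both rows has its entry raised by one; depths that stop being vertical are paid for by
  \<open>lost_verts\<close>.\<close>

lemma upto_col_Suc_Suc:
  assumes "1 \<le> i"
  shows "upto_col (Suc r) (Suc i) \<le> upto_col r i"
proof -
  let ?p = "\<lambda>k. of_bool (vert k (Suc i) \<and> Suc r < k + nvert k (Suc i)) :: nat"
  let ?q = "\<lambda>k. of_bool (vert k i \<and> r < k + nvert k i) :: nat"
  let ?d = "\<lambda>k. of_bool (vert k i \<and> \<not> vert k (Suc i)) :: nat"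
  have "min (L (Suc i)) (bound (Suc i) (Suc r)) + sum ?q {1..r}
      \<le> min (L i) (bound i r) + sum ?p {1..Suc r}"
  proof (cases "vert (Suc r) (Suc i)")
    \<comment> \<open>All smaller depths are then vertical in row \<open>Suc i\<close> too, and the
      box of depth \<open>Suc r\<close> offsets the extra column from
      \<open>bound_Suc_Suc\<close>.\<close>
    case True
    then have "\<And>k. k \<in> {1..r} \<Longrightarrow> vert k (Suc i)"
      using vert_antimono[of "Suc i" _ "Suc r"] by simp
    then have "sum ?q {1..r} \<le> sum ?p {1..r}"
      by (intro sum_mono) (auto simp: nvert_Suc)
    with True L_Suc[OF assms] show ?thesis
      by (simp add: nvert_Suc vert_def bound_Suc_Suc)
  next
    case False
    then have "L (Suc i) \<le> bound i r" by (simp add: vert_def bound_Suc_Suc)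
    from lost_verts[OF assms this]
    have "L (Suc i) + sum ?d {1..r} \<le> min (L i) (bound i r)" .
    moreover have "sum ?q {1..r} \<le> sum ?p {1..r} + sum ?d {1..r}"
      unfolding sum.distrib[symmetric] by (intro sum_mono) (auto simp: nvert_Suc)
    moreover have "sum ?p {1..Suc r} = sum ?p {1..r}" using False by simp
    ultimately show ?thesis by linarith
  qed
  then show ?thesis
    using upto_col_add[OF assms, of r] upto_col_add[of "Suc i" "Suc r"] by linarith
qed

text \<open>The vertical boxes of depth \<open>k\<close> yield \<open>k + 1, k + 2, ...\<close> once
  each, so \<open>s\<close> is among them as soon as there are enough of them.\<close>

lemma sum_mult:
  "(\<Sum>x=1..i. mult x s) = (\<Sum>x=1..i. tops s x) + (\<Sum>k=1..<s. of_bool (s \<le> k + nvert k i))"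
proof -
  have "(\<Sum>x=1..i. of_bool (vert k x \<and> k + nvert k x = s) :: nat) = of_bool (s \<le> k + nvert k i)"
    if "k < s" for k
    using that by (induction i) (auto simp: nvert_Suc, simp add: nvert_def)
  then show ?thesis
    unfolding mult_def sum.distrib
    by (subst sum.swap) simp
qed

lemma tops_Suc_1:
  assumes "1 \<le> s"
  shows "tops (Suc s) 1 = 0"
  using L_add_le_bound[of 1 s] L_add_le_bound[of 1 "Suc s"] assms by (simp add: tops_def)

text \<open>Moving one step northwest sends the nonvertical boxes of depth \<open>Suc s\<close>
  injectively to nonvertical boxes of depth \<open>s\<close>.\<close>

lemma tops_Suc_Suc:
  assumes "1 \<le> s" and "1 \<le> x"
  shows "tops (Suc s) (Suc x) \<le> tops s x"
proof (cases s)
  case (Suc t)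
  then show ?thesis
    using L_Suc[OF assms(2)] bound_less_Suc[OF assms(2), of t]
    by (auto simp: tops_def bound_Suc_Suc)
qed (use assms in simp)

text \<open>Here the last box of row \<open>x\<close> is nonvertical of depth \<open>s\<close> and
  is missed by the northwest shift, as row \<open>Suc x\<close> is no longer than row
  \<open>x\<close>.\<close>

lemma tops_Suc_Suc_less:
  assumes "1 \<le> s" and "1 \<le> x" and "bound x (s - 1) < L x" and "L x < bound x s"
  shows "tops (Suc s) (Suc x) < tops s x"
proof (cases s)
  case (Suc t)
  then show ?thesis
    using L_Suc[OF assms(2)] assms(3,4)
    by (auto simp: tops_def bound_Suc_Suc)
qed (use assms in simp)

text \<open>The last box of the first row containing a box of depth \<open>s\<close> has no box to its southeast.\<close>

lemma exists_strict_top: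
  assumes "1 \<le> s" and "0 < nvert s (Suc i)"
  obtains x where "1 \<le> x" "x \<le> i" "tops (Suc s) (Suc x) < tops s x"
proof -
  obtain y where y: "1 \<le> y" "y \<le> Suc i" "vert s y"
    using assms(2) by (force simp: nvert_def simp del: sum.cl_ivl_Suc dest!: card_gt_0_iff[THEN iffD1])
  then have "s < y" using vert_imp_less assms(1) by blast
  then obtain z where z: "y = Suc z" "1 \<le> z" "z \<le> i"
    using y assms(1) by (cases y) auto
  obtain t where t: "s = Suc t" using assms(1) by (cases s) auto
  let ?Q = "\<lambda>x. 1 \<le> x \<and> bound x t < L x"
  have Qz: "?Q z"
    using y(3) z L_Suc[of z] by (simp add: t vert_def bound_Suc_Suc)
  define x where "x = (LEAST x. ?Q x)"
  have Qx: "?Q x" and xz: "x \<le> z"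
    unfolding x_def by (rule LeastI[of ?Q, OF Qz], rule Least_le[of ?Q, OF Qz])
  \<comment> \<open>By minimality, row \<open>x - 1\<close> ends by column
    \<open>bound (x - 1) t\<close>, which is one less than \<open>bound x s\<close>.\<close>
  have "L x < bound x s"
  proof (cases "x = 1")
    case True
    then show ?thesis using L_add_le_bound[of 1 s] assms(1) by simp
  next
    case False
    then obtain w where w: "x = Suc w" "1 \<le> w" using Qx by (cases x) auto
    then have "\<not> ?Q w" using not_less_Least[of w ?Q] by (auto simp: x_def)
    then show ?thesis using w L_Suc[of w] by (simp add: t bound_Suc_Suc)
  qed
  then have "tops (Suc s) (Suc x) < tops s x"
    using tops_Suc_Suc_less Qx assms(1) t by simp
  with that[of x] Qx xz z show ?thesis by simp
qed

text \<open>The nonvertical boxes are compared by the northwest shift. The strict gain from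
  \<open>exists_strict_top\<close> pays for the entry \<open>Suc s\<close> of a vertical box of
  depth \<open>s\<close>.\<close>

lemma mult_lattice:
  assumes "1 \<le> s"
  shows "(\<Sum>x=1..Suc i. mult x (Suc s)) \<le> (\<Sum>x=1..i. mult x s)"
proof -
  have "(\<Sum>x=1..Suc i. tops (Suc s) x) = (\<Sum>x=1..i. tops (Suc s) (Suc x))"
    using tops_Suc_1[OF assms] by (induction i) auto
  also have "\<dots> + of_bool (0 < nvert s (Suc i)) \<le> (\<Sum>x=1..i. tops s x)"
  proof (cases "0 < nvert s (Suc i)")
    case True
    then obtain x where "1 \<le> x" "x \<le> i" "tops (Suc s) (Suc x) < tops s x"
      using exists_strict_top[OF assms] by blast
    then have "(\<Sum>x=1..i. tops (Suc s) (Suc x)) < (\<Sum>x=1..i. tops s x)"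
      using tops_Suc_Suc[OF assms] by (intro sum_strict_mono_ex1) auto
    with True show ?thesis by simp
  next
    case False
    then show ?thesis using tops_Suc_Suc[OF assms] by (auto intro!: sum_mono)
  qed
  finally have "(\<Sum>x=1..Suc i. tops (Suc s) x) + of_bool (0 < nvert s (Suc i))
      \<le> (\<Sum>x=1..i. tops s x)" .
  \<comment> \<open>One more row raises \<open>nvert k\<close> by at most one; the term
    \<open>k = s\<close> is the extra indicator.\<close>
  moreover have "(\<Sum>k=1..<Suc s. of_bool (Suc s \<le> k + nvert k (Suc i)) :: nat)
      \<le> (\<Sum>k=1..<s. of_bool (s \<le> k + nvert k i)) + of_bool (0 < nvert s (Suc i))"
  proof -
    have "(\<Sum>k=1..<s. of_bool (Suc s \<le> k + nvert k (Suc i)) :: nat)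
        \<le> (\<Sum>k=1..<s. of_bool (s \<le> k + nvert k i))"
      by (intro sum_mono) (auto simp: nvert_Suc split: if_splits)
    then show ?thesis using assms by auto
  qed
  ultimately show ?thesis unfolding sum_mult by linarith
qed

lemma sum_tops_add_vert:
  assumes "1 \<le> i" and "k \<le> N"
  shows "min (L i) (bound i k) + (\<Sum>r\<in>{k<..N}. tops r i + of_bool (vert r i))
           = min (L i) (bound i N)"
  using assms(2)
proof (induction N rule: dec_induct)
  case (step N)
  then have "{k<..Suc N} = insert (Suc N) {k<..N}" by auto
  then show ?case using step tops_add_vert[OF assms(1), of N] by simp
qed simp

text \<open>Each depth \<open>m\<close> up to \<open>k\<close> contributes a given entry
  \<open>r > k\<close> at most once, through a vertical box; subtracting \<open>k\<close> cancels
  these. The rest comes from boxes of depth greater than \<open>k\<close>.\<close>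

lemma sum_mult_minus_le:
  assumes "k \<le> N"
  shows "(\<Sum>r\<in>{k<..N}. (\<Sum>x=1..n. mult x r) - k) \<le> (\<Sum>i=1..n. L i - bound i k)"
proof -
  let ?b = "\<lambda>r m. of_bool (m < r \<and> r \<le> m + nvert m n) :: nat"
  have "(\<Sum>x=1..n. mult x r) - k \<le> (\<Sum>x=1..n. tops r x) + (\<Sum>m\<in>{k<..N}. ?b r m)"
    if r: "r \<in> {k<..N}" for r
  proof -
    have split: "{1..<r} = {1..k} \<union> {k<..<r}" using r by auto
    have "(\<Sum>m=1..<r. of_bool (r \<le> m + nvert m n) :: nat)
        = (\<Sum>m=1..k. of_bool (r \<le> m + nvert m n)) + (\<Sum>m\<in>{k<..<r}. of_bool (r \<le> m + nvert m n))"
      unfolding split by (intro sum.union_disjoint) auto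
    also have "(\<Sum>m=1..k. of_bool (r \<le> m + nvert m n) :: nat) \<le> (\<Sum>m=1..k. 1)"
      by (intro sum_mono) simp
    also have "(\<Sum>m\<in>{k<..<r}. of_bool (r \<le> m + nvert m n) :: nat) = (\<Sum>m\<in>{k<..<r}. ?b r m)"
      by (intro sum.cong) auto
    also have "\<dots> \<le> (\<Sum>m\<in>{k<..N}. ?b r m)"
      using r by (intro sum_mono2) auto
    finally show ?thesis unfolding sum_mult by simp
  qed
  then have "(\<Sum>r\<in>{k<..N}. (\<Sum>x=1..n. mult x r) - k)
      \<le> (\<Sum>r\<in>{k<..N}. (\<Sum>x=1..n. tops r x) + (\<Sum>m\<in>{k<..N}. ?b r m))"
    by (rule sum_mono)
  also have "\<dots> = (\<Sum>r\<in>{k<..N}. \<Sum>x=1..n. tops r x) + (\<Sum>m\<in>{k<..N}. \<Sum>r\<in>{k<..N}. ?b r m)"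
    unfolding sum.distrib by (subst (3) sum.swap) (rule refl)
  also have "(\<Sum>m\<in>{k<..N}. \<Sum>r\<in>{k<..N}. ?b r m) \<le> (\<Sum>m\<in>{k<..N}. nvert m n)"
  proof (intro sum_mono)
    fix m
    have "(\<Sum>r\<in>{k<..N}. ?b r m) = card ({k<..N} \<inter> {r. m < r \<and> r \<le> m + nvert m n})"
      by (simp add: sum.If_cases of_bool_def)
    also have "\<dots> \<le> card {m<..m + nvert m n}"
      by (intro card_mono) auto
    finally show "(\<Sum>r\<in>{k<..N}. ?b r m) \<le> nvert m n" by simp
  qed
  also have "(\<Sum>r\<in>{k<..N}. \<Sum>x=1..n. tops r x) + (\<Sum>m\<in>{k<..N}. nvert m n)
      = (\<Sum>x=1..n. \<Sum>r\<in>{k<..N}. tops r x + of_bool (vert r x))"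
    unfolding nvert_def sum.distrib
    by (intro arg_cong2[where f = "(+)"]; subst sum.swap; rule refl)
  also have "\<dots> \<le> (\<Sum>i=1..n. L i - bound i k)"
  proof (intro sum_mono)
    fix x assume "x \<in> {1..n}"
    then show "(\<Sum>r\<in>{k<..N}. tops r x + of_bool (vert r x)) \<le> L x - bound x k"
      using sum_tops_add_vert[of x k N] assms by (auto simp: min_def split: if_splits)
  qed
  finally show ?thesis by simp
qed


subsection \<open>The upper bound\<close>

text \<open>
  \<open>a i r\<close> is the multiplicity of the entry \<open>r\<close> in row \<open>i\<close>. By the lattice condition, for each
  \<open>c \<le> k\<close> at most one \<open>r\<close> has its \<open>c\<close>-th occurrence in row \<open>Suc i\<close>, whence the summand \<open>k\<close>.
\<close>

lemma sum_min_lattice: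
  fixes a :: "nat \<Rightarrow> nat \<Rightarrow> nat"
  assumes lattice: "\<And>r. 1 \<le> r \<Longrightarrow> (\<Sum>x=1..Suc i. a x (Suc r)) \<le> (\<Sum>x=1..i. a x r)"
    and "k \<le> N"
  shows "(\<Sum>r\<in>{k<..N}. min (\<Sum>x=1..Suc i. a x r) k) \<le> k + (\<Sum>r\<in>{k<..N}. min (\<Sum>x=1..i. a x r) k)"
proof -
  let ?C = "\<lambda>i r. \<Sum>x=1..i. a x r"
  \<comment> \<open>Entry \<open>r + 1\<close> on the left is matched with \<open>r\<close> on the
    right, hence the open range; only \<open>r = k + 1\<close> is unmatched and costs at most
    \<open>k\<close>.\<close>
  have "(\<Sum>r\<in>{k<..N}. min (?C (Suc i) r) k) \<le> k + (\<Sum>r\<in>{k<..<N}. min (?C i r) k)"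
    using \<open>k \<le> N\<close>
  proof (induction N rule: dec_induct)
    case (step N)
    have 1: "{k<..Suc N} = insert (Suc N) {k<..N}" using step by auto
    show ?case
    proof (cases "N = k")
      case True
      then show ?thesis using 1 by simp
    next
      case False
      then have 2: "{k<..<Suc N} = insert N {k<..<N}" using step by auto
      have "?C (Suc i) (Suc N) \<le> ?C i N" using lattice False step by simp
      then have "min (?C (Suc i) (Suc N)) k \<le> min (?C i N) k" by linarith
      then show ?thesis using step.IH unfolding 1 2 by simp
    qed
  qed simp
  also have "(\<Sum>r\<in>{k<..<N}. min (?C i r) k) \<le> (\<Sum>r\<in>{k<..N}. min (?C i r) k)"
    by (intro sum_mono2) auto
  finally show ?thesis by simp
qed

text \<open>Induction on rows: by \<open>col\<close>, row \<open>i > k\<close> has at least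
  \<open>L i - M (i - k)\<close> entries above \<open>k\<close>, and \<open>sum_min_lattice\<close>
  lets at most \<open>k\<close> of them fall into the first \<open>k\<close> columns of the
  content.\<close>

lemma sum_minus_ge:
  fixes a :: "nat \<Rightarrow> nat \<Rightarrow> nat"
  assumes lattice: "\<And>i r. i < n \<Longrightarrow> 1 \<le> r \<Longrightarrow> (\<Sum>x=1..Suc i. a x (Suc r)) \<le> (\<Sum>x=1..i. a x r)"
    and row: "\<And>i. 1 \<le> i \<Longrightarrow> M i + (\<Sum>r=1..N. a i r) = L i"
    and col: "\<And>i. k < i \<Longrightarrow> M i + (\<Sum>r=1..k. a i r) \<le> M (i - k)"
    and "k \<le> N" and "m \<le> n"
  shows "(\<Sum>i=1..m. L i - bound i k) \<le> (\<Sum>r\<in>{k<..N}. (\<Sum>x=1..m. a x r) - k)"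
  using \<open>m \<le> n\<close>
proof (induction m)
  case (Suc m)
  let ?C = "\<lambda>i r. \<Sum>x=1..i. a x r"
  have mono: "(\<Sum>r\<in>{k<..N}. ?C m r - k) \<le> (\<Sum>r\<in>{k<..N}. ?C (Suc m) r - k)"
    by (intro sum_mono) (simp add: diff_le_mono)
  have "(\<Sum>r\<in>{k<..N}. ?C m r - k) + (L (Suc m) - bound (Suc m) k)
      \<le> (\<Sum>r\<in>{k<..N}. ?C (Suc m) r - k)"
  proof (cases "Suc m \<le> k")
    case True
    then have "L (Suc m) - bound (Suc m) k = 0" using L_add_le_bound[of "Suc m" k] by simp
    with mono show ?thesis by simp
  next
    case False
    have split: "(\<Sum>r\<in>{k<..N}. ?C i r - k) + (\<Sum>r\<in>{k<..N}. min (?C i r) k) = (\<Sum>r\<in>{k<..N}. ?C i r)"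
      for i unfolding sum.distrib[symmetric] by (intro sum.cong) auto
    have N: "{1..N} = {1..k} \<union> {k<..N}" using \<open>k \<le> N\<close> by auto
    have 1: "(\<Sum>r=1..N. a (Suc m) r) = (\<Sum>r=1..k. a (Suc m) r) + (\<Sum>r\<in>{k<..N}. a (Suc m) r)"
      unfolding N by (intro sum.union_disjoint) auto
    have 2: "(\<Sum>r\<in>{k<..N}. ?C (Suc m) r) = (\<Sum>r\<in>{k<..N}. ?C m r) + (\<Sum>r\<in>{k<..N}. a (Suc m) r)"
      by (simp add: sum.distrib)
    have 3: "M (Suc m) + (\<Sum>r=1..k. a (Suc m) r) + k \<le> bound (Suc m) k"
      using False col[of "Suc m"] by (simp add: bound_def)
    have min_le: "(\<Sum>r\<in>{k<..N}. min (?C (Suc m) r) k) \<le> k + (\<Sum>r\<in>{k<..N}. min (?C m r) k)"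
      by (rule sum_min_lattice[of a m, OF lattice \<open>k \<le> N\<close>]) (use Suc.prems in simp_all)
    let ?E = "\<lambda>i. \<Sum>r\<in>{k<..N}. ?C i r - k"
    have "?E m + (\<Sum>r\<in>{k<..N}. a (Suc m) r) \<le> ?E (Suc m) + k"
      using 2 split[of m] split[of "Suc m"] min_le by linarith
    moreover have "L (Suc m) + k \<le> bound (Suc m) k + (\<Sum>r\<in>{k<..N}. a (Suc m) r)"
      using 1 3 row[of "Suc m"] by simp
    ultimately show ?thesis using mono by linarith
  qed
  moreover have "(\<Sum>i=1..m. L i - bound i k) \<le> (\<Sum>r\<in>{k<..N}. ?C m r - k)"
    using Suc.IH Suc.prems by simp
  moreover have "(\<Sum>i=1..Suc m. L i - bound i k)
      = (\<Sum>i=1..m. L i - bound i k) + (L (Suc m) - bound (Suc m) k)"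
    by simp
  ultimately show ?case by linarith
qed simp


subsection \<open>Ribbons and the extremal tableau\<close>

definition boxes :: diagram where
  "boxes = (SIGMA i:{1..n}. {M i<..L i})"

definition deep :: "nat \<Rightarrow> diagram" where
  "deep k = {(i, j) \<in> boxes. bound i k < j}"

lemma mem_boxes: "(i, j) \<in> boxes \<longleftrightarrow> 1 \<le> i \<and> M i < j \<and> j \<le> L i"
  using L_eq_0[of i] by (cases "i \<le> n") (auto simp: boxes_def)

lemma finite_boxes: "finite boxes"
  by (simp add: boxes_def)

lemma deep_0: "deep 0 = boxes"
  by (auto simp: deep_def mem_boxes bound_0)

lemma deep_Suc_subset: "deep (Suc k) \<subseteq> deep k"
proof
  fix b assume "b \<in> deep (Suc k)"
  then obtain i j where "b = (i, j)" "(i, j) \<in> boxes" "bound i (Suc k) < j"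
    by (auto simp: deep_def)
  then show "b \<in> deep k"
    using bound_less_Suc[of i k] by (auto simp: deep_def mem_boxes)
qed

text \<open>By \<open>bound_Suc_Suc\<close> the depth boundaries shift along diagonals, so a box has
  depth above \<open>k + 1\<close> exactly if its northwest neighbour exists with depth above
  \<open>k\<close>.\<close>

lemma nw1_deep: "nw1 (deep k) = deep k - deep (Suc k)"
proof -
  have "(i - 1, j - 1) \<in> deep k \<longleftrightarrow> (i, j) \<in> deep (Suc k)" if b: "(i, j) \<in> boxes" for i j
  proof (cases "i = 1")
    case True
    then show ?thesis
      using b L_add_le_bound[of 1 "Suc k"] by (simp add: deep_def mem_boxes)
  next
    case False
    then obtain x where x: "i = Suc x" "1 \<le> x" using b by (cases i) (auto simp: mem_boxes)
    obtain y where y: "j = Suc y" using b by (cases j) (auto simp: mem_boxes)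
    show ?thesis
      using b x(2) L_Suc[OF x(2)] M_le_bound[OF x(2), of k] unfolding x(1) y
      by (auto simp: deep_def mem_boxes bound_Suc_Suc)
  qed
  then show ?thesis by (auto simp: nw1_def deep_def)
qed

lemma boxes_minus_nw: "boxes - (\<Union>l\<in>{1..<Suc k}. nw boxes l) = deep k"
proof (induction k)
  case 0
  then show ?case by (simp add: deep_0)
next
  case (Suc k)
  have "{1..<Suc (Suc k)} = insert (Suc k) {1..<Suc k}" by auto
  then have "boxes - (\<Union>l\<in>{1..<Suc (Suc k)}. nw boxes l)
      = (boxes - (\<Union>l\<in>{1..<Suc k}. nw boxes l)) - nw boxes (Suc k)" by auto
  also have "\<dots> = deep k - nw1 (deep k)"
    by (subst nw.simps) (simp only: Suc)
  finally show ?case using deep_Suc_subset[of k] by (auto simp: nw1_deep)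
qed

lemma pi_nw_add: "pi_nw boxes k + card (deep (Suc k)) = card (deep k)"
proof -
  have "nw boxes (Suc k) = deep k - deep (Suc k)"
    by (subst nw.simps) (simp only: boxes_minus_nw nw1_deep)
  moreover have "finite (deep k)"
    by (rule finite_subset[OF _ finite_boxes]) (auto simp: deep_def)
  ultimately show ?thesis
    using deep_Suc_subset[of k]
    by (simp add: pi_nw_def card_Diff_subset finite_subset card_mono)
qed

lemma card_deep: "card (deep k) = (\<Sum>i=1..n. L i - bound i k)"
proof -
  have "deep k = (SIGMA i:{1..n}. {bound i k<..L i})"
    using M_le_bound[of _ k] by (fastforce simp: deep_def boxes_def)
  then show ?thesis by simp
qed

section \<open>Row multiplicities of semistandard tableaux\<close>

definition row_count :: "(nat \<times> nat \<Rightarrow> nat) \<Rightarrow> nat \<Rightarrow> nat \<Rightarrow> nat" where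
  "row_count T i r = card {j \<in> {M i<..L i}. T (i, j) = r}"

lemma sum_row_count:
  assumes "semistandard boxes T" and "1 \<le> i"
  shows "(\<Sum>r=1..k. row_count T i r) = card {j \<in> {M i<..L i}. T (i, j) \<le> k}"
proof -
  let ?S = "{j \<in> {M i<..L i}. T (i, j) \<le> k}"
  have pos: "1 \<le> T (i, j)" if "j \<in> {M i<..L i}" for j
    using assms that by (auto simp: semistandard_def mem_boxes)
  have "row_count T i r = card {j \<in> ?S. T (i, j) = r}" if "r \<in> {1..k}" for r
    unfolding row_count_def using that by (intro arg_cong[where f = card]) auto
  then have "(\<Sum>r=1..k. row_count T i r) = (\<Sum>r=1..k. card {j \<in> ?S. T (i, j) = r})"
    by simp
  also have "\<dots> = (\<Sum>r=1..k. \<Sum>j\<in>{j \<in> ?S. T (i, j) = r}. 1)" by simp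
  also have "\<dots> = (\<Sum>j\<in>?S. 1)"
    by (rule sum.group) (use pos in auto)
  finally show ?thesis by simp
qed

lemma card_content: "card {b \<in> boxes. T b = r} = (\<Sum>i=1..n. row_count T i r)"
proof -
  have "{b \<in> boxes. T b = r} = (SIGMA i:{1..n}. {j \<in> {M i<..L i}. T (i, j) = r})"
    by (auto simp: boxes_def)
  then show ?thesis by (simp add: row_count_def)
qed

lemma semistandard_add_le:
  assumes T: "semistandard boxes T" and "(i, j) \<in> boxes" and "(i + d, j) \<in> boxes"
  shows "T (i, j) + d \<le> T (i + d, j)"
  using assms(3)
proof (induction d)
  case (Suc d)
  have box: "(i + d, j) \<in> boxes"
    using Suc.prems assms(2) L_Suc[of "i + d"] M_antimono[of i "i + d"] by (simp add: mem_boxes)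
  have "T (i + d, j) < T (i + Suc d, j)"
    using T box Suc.prems by (auto simp: semistandard_def)
  with Suc.IH[OF box] show ?case by simp
qed simp

text \<open>Beyond column \<open>M (i - k)\<close> the column of the box reaches up to row
  \<open>i - k\<close>, so strictness forces an entry of at least \<open>k + 1\<close>.\<close>

lemma row_count_col:
  assumes T: "semistandard boxes T" and "k < i"
  shows "M i + (\<Sum>r=1..k. row_count T i r) \<le> M (i - k)"
proof -
  have "{j \<in> {M i<..L i}. T (i, j) \<le> k} \<subseteq> {M i<..M (i - k)}"
  proof (intro subsetI, rule ccontr)
    fix j assume j: "j \<in> {j \<in> {M i<..L i}. T (i, j) \<le> k}" "j \<notin> {M i<..M (i - k)}"
    then have box: "(i - k, j) \<in> boxes" "(i - k + k, j) \<in> boxes"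
      using assms(2) L_antimono[of "i - k" i] by (auto simp: mem_boxes Suc_le_eq)
    then have "1 \<le> T (i - k, j)" using T by (auto simp: semistandard_def)
    with semistandard_add_le[OF T box] j assms(2) show False by simp
  qed
  then have "card {j \<in> {M i<..L i}. T (i, j) \<le> k} \<le> M (i - k) - M i"
    using card_mono[of "{M i<..M (i - k)}"] by fastforce
  moreover have "M i \<le> M (i - k)" using M_antimono[of "i - k" i] assms(2) by simp
  moreover have "1 \<le> i" using assms(2) by simp
  ultimately show ?thesis unfolding sum_row_count[OF T \<open>1 \<le> i\<close>] by linarith
qed

section \<open>The sorted extremal filling as a tableau\<close>

definition tab :: "nat \<times> nat \<Rightarrow> nat" where
  "tab = (\<lambda>(i, j). if (i, j) \<in> boxes then LEAST r. j \<le> upto_col r i else 0)"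

lemma tab_le_iff:
  assumes "(i, j) \<in> boxes"
  shows "tab (i, j) \<le> r \<longleftrightarrow> j \<le> upto_col r i"
proof
  assume "j \<le> upto_col r i"
  then show "tab (i, j) \<le> r" using assms by (simp add: tab_def Least_le)
next
  assume "tab (i, j) \<le> r"
  \<comment> \<open>This shows that the \<open>LEAST\<close> in \<open>tab\<close> is
    attained.\<close>
  have "j \<le> upto_col i i" using assms upto_col_eq_L[of i i] by (simp add: mem_boxes)
  then have "j \<le> upto_col (tab (i, j)) i"
    using assms LeastI[of "\<lambda>r. j \<le> upto_col r i" i] by (simp add: tab_def)
  also have "\<dots> \<le> upto_col r i" using \<open>tab (i, j) \<le> r\<close> by (rule upto_col_mono)
  finally show "j \<le> upto_col r i" .
qed

lemma tab_pos: "(i, j) \<in> boxes \<Longrightarrow> 1 \<le> tab (i, j)"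
  using tab_le_iff[of i j 0] by (simp add: upto_col_def mem_boxes)

lemma upto_col_Suc_le:
  assumes "1 \<le> i" and "i < x"
  shows "upto_col (Suc r) x \<le> upto_col r i"
proof -
  from assms(2) have "Suc i \<le> x" by simp
  then show ?thesis
  proof (induction x rule: dec_induct)
    case base
    then show ?case using upto_col_Suc_Suc assms(1) by simp
  next
    case (step x)
    then show ?case
      using upto_col_Suc_Suc[of x r] upto_col_mono[of r "Suc r" x] by simp
  qed
qed

lemma semistandard_tab: "semistandard boxes tab"
  unfolding semistandard_def
proof (intro conjI allI ballI impI; (elim conjE)?)
  fix b assume "b \<notin> boxes"
  then show "tab b = 0" by (cases b) (simp add: tab_def)
next
  fix b assume "b \<in> boxes"
  then show "1 \<le> tab b" by (cases b) (simp add: tab_pos[simplified])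
next
  fix i j j' assume "(i, j) \<in> boxes" "(i, j') \<in> boxes" "j < j'"
  moreover from this(2) have "j' \<le> upto_col (tab (i, j')) i" by (simp add: tab_le_iff[symmetric])
  ultimately show "tab (i, j) \<le> tab (i, j')" by (simp add: tab_le_iff)
next
  fix i i' j assume b: "(i, j) \<in> boxes" "(i', j) \<in> boxes" "i < i'"
  obtain t where t: "tab (i', j) = Suc t" using tab_pos[OF b(2)] by (cases "tab (i', j)") auto
  then have "j \<le> upto_col (Suc t) i'" using tab_le_iff[OF b(2), of "Suc t"] by simp
  also have "\<dots> \<le> upto_col t i" using upto_col_Suc_le b by (simp add: mem_boxes)
  finally show "tab (i, j) < tab (i', j)" using tab_le_iff[OF b(1), of t] t by (simp add: less_Suc_eq_le)
qed

lemma row_count_tab: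
  assumes "1 \<le> i" and "1 \<le> r"
  shows "row_count tab i r = mult i r"
proof -
  obtain t where t: "r = Suc t" using assms(2) by (cases r) auto
  have "{j \<in> {M i<..L i}. tab (i, j) = Suc t} = {upto_col t i<..upto_col (Suc t) i}"
  proof -
    have "tab (i, j) = Suc t \<longleftrightarrow> upto_col t i < j \<and> j \<le> upto_col (Suc t) i"
      if "j \<in> {M i<..L i}" for j
    proof -
      have "(i, j) \<in> boxes" using that assms(1) by (simp add: mem_boxes)
      then show ?thesis using tab_le_iff[of i j t] tab_le_iff[of i j "Suc t"] by auto
    qed
    moreover have "M i \<le> upto_col t i" by (simp add: upto_col_def)
    ultimately show ?thesis using upto_col_le[OF assms(1), of "Suc t"] by force
  qed
  then show ?thesis by (simp add: row_count_def t upto_col_def)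
qed

lemma mult_eq_0:
  assumes "1 \<le> i" and "i < s"
  shows "mult i s = 0"
proof -
  obtain t where t: "s = Suc t" "i \<le> t" using assms(2) by (cases s) auto
  then show ?thesis
    using upto_col_eq_L[OF assms(1), of t] upto_col_eq_L[OF assms(1), of s]
    by (simp add: upto_col_def)
qed

end


section \<open>Partitions and hooks\<close>

lemma part_antimono:
  assumes "is_partition p" and "1 \<le> i" and "i \<le> j"
  shows "part p j \<le> part p i"
  using assms sorted_wrt_nth_less[of "(\<ge>)" p "i - 1" "j - 1"]
  by (cases "i = j") (auto simp: part_def is_partition_def)

lemma part_eq_0: "length p < i \<Longrightarrow> part p i = 0"
  by (simp add: part_def)

lemma exists_partition:
  assumes dec: "\<And>i. 1 \<le> i \<Longrightarrow> g (Suc i) \<le> g i" and zero: "g (Suc N) = 0"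
  obtains p where "is_partition p" and "\<And>i. 1 \<le> i \<Longrightarrow> part p i = g i"
proof -
  define l where "l = (LEAST l. g (Suc l) = 0)"
  have l: "g (Suc l) = 0" unfolding l_def by (rule LeastI[of _ N]) (rule zero)
  have pos: "g (Suc i) \<noteq> 0" if "i < l" for i using not_less_Least that by (auto simp: l_def)
  have anti: "g j \<le> g i" if "1 \<le> i" "i \<le> j" for i j
    using that(2)
  proof (induction j rule: dec_induct)
    case (step j)
    then show ?case using dec[of j] that(1) by linarith
  qed simp
  let ?p = "map (\<lambda>i. g (Suc i)) [0..<l]"
  have "is_partition ?p"
    using pos anti by (auto simp: is_partition_def sorted_wrt_iff_nth_less image_iff)
  moreover have "part ?p i = g i" if "1 \<le> i" for i
    using that anti[of "Suc l" i] l by (auto simp: part_def)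
  ultimately show ?thesis by (rule that)
qed

text \<open>What remains of the Young diagram after removing its first \<open>k\<close> diagonal
  hooks.\<close>

definition beyond :: "nat list \<Rightarrow> nat \<Rightarrow> diagram" where
  "beyond p k = {(r, c) \<in> young p. k < r \<and> k < c}"

lemma beyond_eq:
  assumes "length p \<le> N"
  shows "beyond p k = (SIGMA r:{k<..N}. {k<..part p r})"
proof -
  have "r \<le> N" if "0 < part p r" for r
    using part_eq_0[of p r] assms that by (cases "r \<le> length p") auto
  then show ?thesis by (fastforce simp: beyond_def young_def)
qed

lemma card_beyond: "length p \<le> N \<Longrightarrow> card (beyond p k) = (\<Sum>r\<in>{k<..N}. part p r - k)"
  by (simp add: beyond_eq)

lemma hl_add:
  assumes "is_partition p"
  shows "hl p k + card (beyond p (Suc k)) = card (beyond p k)"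
proof -
  have fin: "finite (beyond p l)" for l by (simp add: beyond_eq[OF order_refl])
  have sub: "beyond p (Suc k) \<subseteq> beyond p k" by (auto simp: beyond_def)
  have "hl p k = card (beyond p k - beyond p (Suc k))"
  proof (cases "(Suc k, Suc k) \<in> young p")
    case True
    have "{(r, c) \<in> young p. (r = Suc k \<and> Suc k \<le> c) \<or> (c = Suc k \<and> Suc k \<le> r)}
        = beyond p k - beyond p (Suc k)"
      by (auto simp: beyond_def)
    with True show ?thesis by (simp add: hl_def hook_length_def)
  next
    case False
    then have "part p (Suc k) \<le> k" by (simp add: young_def)
    then have "part p r \<le> k" if "k < r" for r
      using part_antimono[OF assms, of "Suc k" r] that by simp
    then have "beyond p k = {}"
      by (fastforce simp: beyond_def young_def)
    with False show ?thesis by (simp add: hl_def hook_length_def)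
  qed
  then show ?thesis using fin sub by (simp add: card_Diff_subset card_mono)
qed


section \<open>Lattice words of tableaux\<close>

lemma take_concat_cases:
  assumes "rows \<noteq> []"
  obtains i q where "i < length rows" "take m (concat rows) = concat (take i rows) @ take q (rows ! i)"
proof -
  have "\<exists>i<length rows. \<exists>q. take m (concat rows) = concat (take i rows) @ take q (rows ! i)"
    using assms
  proof (induction rows arbitrary: m)
    case (Cons r rs)
    show ?case
    proof (cases "m \<le> length r \<or> rs = []")
      case True
      then show ?thesis by (intro exI[of _ 0]) (auto intro: exI[of _ m])
    next
      case False
      with Cons.IH[of "m - length r"] obtain i q where
        "i < length rs" "take (m - length r) (concat rs) = concat (take i rs) @ take q (rs ! i)"
        by blast
      with False show ?thesis by (intro exI[of _ "Suc i"]) auto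
    qed
  qed simp
  with that show ?thesis by blast
qed

text \<open>Within a row the worst case has all its \<open>Suc k\<close> read and none of its
  \<open>k\<close>, so the row ends suffice.\<close>

lemma lattice_word_concat:
  assumes "\<And>i k. i < length rows \<Longrightarrow> 1 \<le> k \<Longrightarrow>
    count_list (concat (take (Suc i) rows)) (Suc k) \<le> count_list (concat (take i rows)) k"
  shows "lattice_word (concat rows)"
  unfolding lattice_word_def
proof (intro allI impI)
  fix m k :: nat assume k: "1 \<le> k"
  show "count_list (take m (concat rows)) (Suc k) \<le> count_list (take m (concat rows)) k"
  proof (cases "rows = []")
    case False
    then obtain i q where i: "i < length rows"
      and eq: "take m (concat rows) = concat (take i rows) @ take q (rows ! i)"
      by (rule take_concat_cases)
    have "count_list (take q (rows ! i)) (Suc k) \<le> count_list (rows ! i) (Suc k)"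
      by (metis append_take_drop_id count_list_append le_add1)
    with assms[OF i k] i show ?thesis by (simp add: eq take_Suc_conv_app_nth)
  qed simp
qed

text \<open>A row is read in weakly decreasing order, so the prefix stopping after its entries above
  \<open>k\<close> realizes that worst case.\<close>

lemma lattice_word_row:
  assumes lw: "lattice_word (ys @ row @ zs)" and sorted: "sorted_wrt (\<ge>) row" and "1 \<le> k"
  shows "count_list ys (Suc k) + count_list row (Suc k) \<le> count_list ys k"
proof -
  let ?t = "takeWhile (\<lambda>x. k < x) row"
  have 1: "count_list ?t (Suc k) = count_list row (Suc k)"
    using sorted by (induction row) (auto simp: count_list_0_iff)
  have 2: "count_list ?t k = 0"
    by (auto simp: count_list_0_iff dest: set_takeWhileD)
  have "ys @ row @ zs = (ys @ ?t) @ dropWhile (\<lambda>x. k < x) row @ zs" by simp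
  then have "take (length (ys @ ?t)) (ys @ row @ zs) = ys @ ?t"
    by (metis append_eq_conv_conj)
  with lw \<open>1 \<le> k\<close> have "count_list (ys @ ?t) (Suc k) \<le> count_list (ys @ ?t) k"
    unfolding lattice_word_def by metis
  with 1 2 show ?thesis by simp
qed

lemma count_list_concat_rows:
  "count_list (concat (map f [1..<Suc i])) r = (\<Sum>x=1..i. count_list (f x) r)"
  by (induction i) auto

lemma count_list_row:
  "count_list (map f (rev [Suc m..<Suc l])) r = card {j \<in> {m<..l}. f j = r}"
proof -
  have "count_list (map f (rev [Suc m..<Suc l])) r = card ({j. r = f j} \<inter> set (rev [Suc m..<Suc l]))"
    unfolding count_list_eq_length_filter filter_map length_map
    by (subst distinct_length_filter) (auto simp: comp_def)
  also have "{j. r = f j} \<inter> set (rev [Suc m..<Suc l]) = {j \<in> {m<..l}. f j = r}" by auto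
  finally show ?thesis .
qed


section \<open>Extremality\<close>

text \<open>At the first index where \<open>h\<close> and \<open>p\<close> differ the tails still
  agree, and the larger next tail of \<open>h\<close> makes its term smaller.\<close>

lemma less_fun_of_tails:
  fixes h p e f :: "nat \<Rightarrow> nat"
  assumes h: "\<And>k. h k + e (Suc k) = e k" and p: "\<And>k. p k + f (Suc k) = f k"
    and "e 0 = f 0" and le: "\<And>k. f k \<le> e k"
  shows "h = p \<or> less_fun h p"
proof (cases "h = p")
  case False
  then obtain k where "h k \<noteq> p k" by auto
  define m where "m = (LEAST k. h k \<noteq> p k)"
  have m: "h m \<noteq> p m" unfolding m_def by (rule LeastI) fact
  have below: "h k = p k" if "k < m" for k using not_less_Least that by (auto simp: m_def)
  have "e k = f k" if "k \<le> m" for k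
    using that
  proof (induction k)
    case (Suc k)
    then show ?case using h[of k] p[of k] below[of k] by simp
  qed (simp add: \<open>e 0 = f 0\<close>)
  from this[of m] have "h m < p m" using m h[of m] p[of m] le[of "Suc m"] by linarith
  with below show ?thesis by (auto simp: less_fun_def)
qed simp

lemma lex_greatest_eqI:
  assumes "h \<in> S" and "\<And>h'. h' \<in> S \<Longrightarrow> h' = h \<or> less_fun h' h"
  shows "lex_greatest S = h"
  unfolding lex_greatest_def
proof (rule the_equality)
  fix g assume "g \<in> S \<and> (\<forall>h'\<in>S. h' = g \<or> less_fun h' g)"
  then have "h = g \<or> less_fun h g" and "g = h \<or> less_fun g h" using assms by simp_all
  then show "g = h" using less_fun_asym[of g h] by argo
qed (use assms in blast)

section \<open>Littlewood-Richardson tableaux of a fixed skew shape\<close>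

context
  fixes lam mu :: "nat list"
  assumes lam: "is_partition lam" and mu: "is_partition mu" and sub: "young mu \<subseteq> young lam"
begin

interpretation skew_shape "part lam" "part mu" "length lam"
proof
  fix i
  show "part mu i \<le> part lam i"
  proof (rule ccontr)
    assume "\<not> part mu i \<le> part lam i"
    then have "(i, part mu i) \<in> young mu - young lam"
      by (auto simp: young_def part_def split: if_splits)
    with sub show False by blast
  qed
qed (simp_all add: part_antimono[OF lam] part_antimono[OF mu] part_eq_0)

lemma skew_eq_boxes: "skew lam mu = boxes"
  by (auto simp: skew_def young_def mem_boxes)

lemma lattice_word_tableau_word_iff:
  assumes T: "semistandard boxes T"
  shows "lattice_word (tableau_word lam mu T) \<longleftrightarrow>
    (\<forall>i k. i < length lam \<longrightarrow> 1 \<le> k \<longrightarrow>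
      (\<Sum>x=1..Suc i. row_count T x (Suc k)) \<le> (\<Sum>x=1..i. row_count T x k))"
proof -
  define row where "row = (\<lambda>i. map (\<lambda>j. T (i, j)) (rev [Suc (part mu i)..<Suc (part lam i)]))"
  define rows where "rows = map row [1..<Suc (length lam)]"
  have word: "tableau_word lam mu T = concat rows"
    by (simp only: tableau_word_def rows_def row_def)
  have len: "length rows = length lam" by (simp add: rows_def del: upt_Suc)
  have count: "count_list (concat (take i rows)) r = (\<Sum>x=1..i. row_count T x r)"
    if "i \<le> length lam" for i r
  proof -
    have "take i rows = map row [1..<Suc i]"
      using that take_upt[of 1 i "Suc (length lam)"] by (simp only: rows_def take_map) simp
    then show ?thesis by (simp only: count_list_concat_rows row_def count_list_row row_count_def)
  qed
  show ?thesis
  proof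
    assume lw: "lattice_word (tableau_word lam mu T)"
    show "\<forall>i k. i < length lam \<longrightarrow> 1 \<le> k \<longrightarrow>
      (\<Sum>x=1..Suc i. row_count T x (Suc k)) \<le> (\<Sum>x=1..i. row_count T x k)"
    proof (intro allI impI)
      fix i k :: nat assume i: "i < length lam" and k: "1 \<le> k"
      have "concat rows = concat (take i rows) @ rows ! i @ concat (drop (Suc i) rows)"
        using i len by (metis concat.simps(2) concat_append id_take_nth_drop)
      moreover have "sorted_wrt (\<ge>) (rows ! i)"
      proof -
        have "rows ! i = row (Suc i)" using i by (simp add: rows_def del: upt_Suc)
        moreover have "sorted (map (\<lambda>j. T (Suc i, j)) [Suc (part mu (Suc i))..<Suc (part lam (Suc i))])"
        proof -
          have "T (Suc i, j) \<le> T (Suc i, j')"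
            if "part mu (Suc i) < j" "j < j'" "j' \<le> part lam (Suc i)" for j j'
            using T that by (simp add: semistandard_def mem_boxes)
          then show ?thesis by (auto simp: sorted_iff_nth_mono_less simp del: upt_Suc)
        qed
        ultimately show ?thesis by (simp add: row_def rev_map[symmetric] sorted_wrt_rev)
      qed
      ultimately have "count_list (concat (take i rows)) (Suc k) + count_list (rows ! i) (Suc k)
          \<le> count_list (concat (take i rows)) k"
        using lattice_word_row lw k unfolding word by metis
      then have "count_list (concat (take (Suc i) rows)) (Suc k) \<le> count_list (concat (take i rows)) k"
        using i len by (simp add: take_Suc_conv_app_nth)
      then show "(\<Sum>x=1..Suc i. row_count T x (Suc k)) \<le> (\<Sum>x=1..i. row_count T x k)"
        using i by (simp only: count Suc_leI less_imp_le)
    qed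
  next
    assume *: "\<forall>i k. i < length lam \<longrightarrow> 1 \<le> k \<longrightarrow>
      (\<Sum>x=1..Suc i. row_count T x (Suc k)) \<le> (\<Sum>x=1..i. row_count T x k)"
    show "lattice_word (tableau_word lam mu T)"
      unfolding word
    proof (rule lattice_word_concat)
      fix i k assume "i < length rows" and "1 \<le> (k :: nat)"
      with * show "count_list (concat (take (Suc i) rows)) (Suc k) \<le> count_list (concat (take i rows)) k"
        by (simp only: count len Suc_leI less_imp_le)
    qed
  qed
qed

lemma LR_tableau_le_length:
  assumes T: "T \<in> LR_tableaux lam mu nu" and b: "b \<in> boxes"
  shows "T b \<le> length nu"
proof -
  have "1 \<le> T b" using T b by (auto simp: LR_tableaux_def semistandard_def skew_eq_boxes)
  moreover have "b \<in> {c \<in> boxes. T c = T b}" using b by simp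
  then have "card {c \<in> boxes. T c = T b} \<noteq> 0"
    using finite_boxes by (metis (no_types, lifting) card_eq_0_iff empty_iff finite_subset mem_Collect_eq subsetI)
  ultimately have "part nu (T b) \<noteq> 0" using T by (simp add: LR_tableaux_def skew_eq_boxes)
  then show ?thesis by (auto simp: part_def split: if_splits)
qed

text \<open>Needed because \<open>card\<close> is 0 on infinite sets: only then does a tableau force
  a nonzero coefficient.\<close>

lemma finite_LR_tableaux: "finite (LR_tableaux lam mu nu)"
proof (rule finite_subset)
  show "finite {T. \<forall>b. (b \<in> boxes \<longrightarrow> T b \<in> {..length nu}) \<and> (b \<notin> boxes \<longrightarrow> T b = (0::nat))}"
    by (intro finite_set_of_finite_funs finite_boxes) simp
  show "LR_tableaux lam mu nu
      \<subseteq> {T. \<forall>b. (b \<in> boxes \<longrightarrow> T b \<in> {..length nu}) \<and> (b \<notin> boxes \<longrightarrow> T b = 0)}"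
  proof (intro subsetI CollectI allI conjI impI)
    fix T b assume T: "T \<in> LR_tableaux lam mu nu" and b: "b \<in> boxes"
    show "T b \<in> {..length nu}" using LR_tableau_le_length[OF T b] by simp
  next
    fix T b assume "T \<in> LR_tableaux lam mu nu" and "b \<notin> boxes"
    then show "T b = 0" by (cases b) (simp add: LR_tableaux_def semistandard_def skew_eq_boxes)
  qed
qed

lemma appears_iff:
  "appears_in nu (skew_char lam mu) \<longleftrightarrow> is_partition nu \<and> LR_tableaux lam mu nu \<noteq> {}"
  using finite_LR_tableaux[of nu] sub by (auto simp: appears_in_def skew_char_def LR_coeff_def)

lemma LR_tableau_bounds:
  assumes T: "T \<in> LR_tableaux lam mu nu"
  shows "card (beyond nu 0) = card (deep 0)" and "card (deep k) \<le> card (beyond nu k)"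
proof -
  have ss: "semistandard boxes T" using T by (simp add: LR_tableaux_def skew_eq_boxes)
  have cont: "(\<Sum>i=1..length lam. row_count T i r) = part nu r" if "1 \<le> r" for r
    using T that by (simp add: LR_tableaux_def skew_eq_boxes card_content)
  have row: "part mu i + (\<Sum>r=1..N. row_count T i r) = part lam i"
    if "1 \<le> i" and "length nu \<le> N" for i N
  proof -
    have "{j \<in> {part mu i<..part lam i}. T (i, j) \<le> N} = {part mu i<..part lam i}"
      using LR_tableau_le_length[OF T] that by (force simp: mem_boxes)
    then show ?thesis using M_le_L[of i] by (simp only: sum_row_count[OF ss that(1)]) simp
  qed
  have lattice: "(\<Sum>x=1..Suc i. row_count T x (Suc r)) \<le> (\<Sum>x=1..i. row_count T x r)"
    if "i < length lam" "1 \<le> r" for i r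
    using T that lattice_word_tableau_word_iff[OF ss] by (simp only: LR_tableaux_def mem_Collect_eq)
  show "card (deep k) \<le> card (beyond nu k)"
  proof -
    \<comment> \<open>The upper limit \<open>length nu + k\<close> is at least \<open>k\<close> and
      also bounds all entries.\<close>
    have "card (deep k) \<le> (\<Sum>r\<in>{k<..length nu + k}. (\<Sum>x=1..length lam. row_count T x r) - k)"
      unfolding card_deep
      by (rule sum_minus_ge[OF lattice row row_count_col[OF ss]]) simp_all
    also have "\<dots> = (\<Sum>r\<in>{k<..length nu + k}. part nu r - k)"
      by (intro sum.cong refl) (subst cont, auto)
    finally show ?thesis by (simp only: card_beyond[of nu "length nu + k"] le_add1)
  qed
  have "card (beyond nu 0) = (\<Sum>r=1..length nu. part nu r)"
    by (simp add: card_beyond[of nu "length nu"] atLeastSucAtMost_greaterThanAtMost[symmetric])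
  also have "\<dots> = (\<Sum>r=1..length nu. \<Sum>i=1..length lam. row_count T i r)"
    by (intro sum.cong refl) (subst cont, auto)
  also have "\<dots> = (\<Sum>i=1..length lam. \<Sum>r=1..length nu. row_count T i r)" by (rule sum.swap)
  also have "\<dots> = (\<Sum>i=1..length lam. part lam i - bound i 0)"
  proof (intro sum.cong refl)
    fix i assume "i \<in> {1..length lam}"
    then show "(\<Sum>r=1..length nu. row_count T i r) = part lam i - bound i 0"
      using row[of i "length nu"] by (simp add: bound_0)
  qed
  finally show "card (beyond nu 0) = card (deep 0)" by (simp only: card_deep)
qed

lemma hl_le_pi_nw:
  assumes "is_partition nu" and "T \<in> LR_tableaux lam mu nu"
  shows "hl nu = pi_nw (skew lam mu) \<or> less_fun (hl nu) (pi_nw (skew lam mu))"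
  unfolding skew_eq_boxes
  by (rule less_fun_of_tails[where e = "\<lambda>k. card (beyond nu k)" and f = "\<lambda>k. card (deep k)"])
    (use hl_add pi_nw_add LR_tableau_bounds assms in auto)

lemma exists_extremal_tableau:
  obtains nu where "is_partition nu" "tab \<in> LR_tableaux lam mu nu" "hl nu = pi_nw (skew lam mu)"
proof -
  \<comment> \<open>The content of \<open>tab\<close>; it is a partition by
    \<open>mult_lattice\<close> and because row \<open>i\<close> has no entries above
    \<open>i\<close>.\<close>
  let ?g = "\<lambda>r. \<Sum>x=1..length lam. mult x r"
  have "?g (Suc r) \<le> ?g r" if "1 \<le> r" for r
    using mult_lattice[OF that, of "length lam"] by simp
  moreover have "?g (Suc (length lam)) = 0"
    by (simp add: mult_eq_0)
  ultimately obtain nu where nu: "is_partition nu" and part_nu: "\<And>r. 1 \<le> r \<Longrightarrow> part nu r = ?g r"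
    using exists_partition[of ?g] by blast
  have counts: "(\<Sum>x=1..i. row_count tab x r) = (\<Sum>x=1..i. mult x r)" if "1 \<le> r" for i r
    using that by (intro sum.cong) (auto simp: row_count_tab)
  have "lattice_word (tableau_word lam mu tab)"
    unfolding lattice_word_tableau_word_iff[OF semistandard_tab]
  proof (intro allI impI)
    fix i k :: nat assume k: "1 \<le> k"
    then show "(\<Sum>x=1..Suc i. row_count tab x (Suc k)) \<le> (\<Sum>x=1..i. row_count tab x k)"
      using mult_lattice[OF k] counts[OF k] counts[of "Suc k"] by (metis le_SucI)
  qed
  then have tab: "tab \<in> LR_tableaux lam mu nu"
    using semistandard_tab counts part_nu
    by (simp add: LR_tableaux_def skew_eq_boxes card_content)
  have "card (beyond nu k) \<le> card (deep k)" for k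
  proof -
    have "card (beyond nu k) = (\<Sum>r\<in>{k<..length nu + k}. part nu r - k)"
      by (simp only: card_beyond[of nu "length nu + k"] le_add1)
    also have "\<dots> = (\<Sum>r\<in>{k<..length nu + k}. ?g r - k)"
      by (intro sum.cong refl) (subst part_nu, auto)
    also have "\<dots> \<le> card (deep k)"
      unfolding card_deep by (rule sum_mult_minus_le) simp
    finally show ?thesis .
  qed
  then have eq: "card (beyond nu k) = card (deep k)" for k
    using LR_tableau_bounds(2)[OF tab] by (simp add: le_antisym)
  have "hl nu k = pi_nw boxes k" for k
    using hl_add[OF nu, of k] pi_nw_add[of k] by (simp add: eq)
  then have "hl nu = pi_nw (skew lam mu)" by (auto simp: skew_eq_boxes)
  with nu tab show ?thesis by (rule that)
qed

end

theorem theorem4p5: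
  fixes lam mu :: "nat list"
  assumes "is_partition lam" and "is_partition mu" and "young mu \<subseteq> young lam"
  shows "hl_skew lam mu = pi_nw (skew lam mu)"
  unfolding hl_skew_def
proof (rule lex_greatest_eqI)
  show "pi_nw (skew lam mu) \<in> {hl nu |nu. appears_in nu (skew_char lam mu)}"
    using exists_extremal_tableau[OF assms] appears_iff[OF assms]
    by (metis (mono_tags, lifting) empty_iff mem_Collect_eq)
  fix h assume "h \<in> {hl nu |nu. appears_in nu (skew_char lam mu)}"
  then show "h = pi_nw (skew lam mu) \<or> less_fun h (pi_nw (skew lam mu))"
    using hl_le_pi_nw[OF assms] appears_iff[OF assms] by blast
qed

end
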